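(* Let $\mathcal{F}$ be a finite family of nonempty compact convex sets in $\mathbb{R}^2$ such that every three sets in $\mathcal{F}$ form a tight triple. Then there is a line in the plane intersecting at least $\frac{1}{3}|\mathcal{F}|$ members of $\mathcal{F}$.
   Context: Three compact connected sets $A,B,C$ in the plane form a tight triple if $\operatorname{conv}(A\cup B)\cap\operatorname{conv}(A\cup C)\cap\operatorname{conv}(B\cup C)\neq\emptyset$, where $\operatorname{conv}$ denotes the convex hull. *)

theory Defs
  imports "HOL-Analysis.Analysis"
begin

definition tight_triple :: "(real ^ 2) set \<Rightarrow> (real ^ 2) set \<Rightarrow> (real ^ 2) set \<Rightarrow> bool" where
  "tight_triple A B C \<longleftrightarrow>
     compact A \<and> connected A \<and> compact B \<and> connected B \<and> compact C \<and> connected C \<and>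
     convex hull (A \<union> B) \<inter> convex hull (A \<union> C) \<inter> convex hull (B \<union> C) \<noteq> {}"

definition is_line :: "(real ^ 2) set \<Rightarrow> bool" where
  "is_line L \<longleftrightarrow> affine L \<and> aff_dim L = 1"

end

theory Submission
  imports Defs
begin

text \<open>
  Enclose all sets in an open disc and parametrise six points on its circle by the six arc lengths
  between them, i.e. by a point of a 5-simplex. The three chords joining opposite points bound six
  wedges, one over each arc, which together contain every point off the chords. A wedge over an arc
  of length zero is empty inside the disc, so a KKM-type argument yields either six points such that
  no wedge contains a member of the family, or six points such that every wedge contains one. In the
  first case every member is connected and hence meets one of the three chord lines. In the second
  case tightness, applied to the members in the even and in the odd wedges, gives two points on
  opposite sides of all three lines with alternating signs; this contradicts a linear dependency of
  the three normals. Hence three lines meet all members, and one of them meets at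
  least a third.
\<close>

section \<open>A KKM-type lemma\<close>

definition unit_simplex :: "(real ^ 'n::finite) set" where
  "unit_simplex = {x. (\<forall>i. 0 \<le> x $ i) \<and> (\<Sum>i\<in>UNIV. x $ i) = 1}"

lemma convex_unit_simplex: "convex (unit_simplex :: (real ^ 'n::finite) set)"
  unfolding convex_def unit_simplex_def
  by (auto simp: sum.distrib sum_distrib_left[symmetric])

lemma compact_unit_simplex: "compact (unit_simplex :: (real ^ 'n::finite) set)"
proof -
  have "closed (unit_simplex :: (real ^ 'n) set)"
    unfolding unit_simplex_def
    by (intro closed_Collect_conj closed_Collect_all closed_Collect_le closed_Collect_eq
        continuous_intros)
  moreover have "unit_simplex \<subseteq> cbox (0 :: real ^ 'n) 1"
  proof
    fix x :: "real ^ 'n" assume x: "x \<in> unit_simplex"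
    have "x $ i \<le> 1" for i
      using member_le_sum[of i UNIV "\<lambda>i. x $ i"] x by (auto simp: unit_simplex_def)
    then show "x \<in> cbox 0 1" using x by (auto simp: mem_box_cart unit_simplex_def)
  qed
  ultimately show ?thesis
    using bounded_subset[OF bounded_cbox] compact_eq_bounded_closed by blast
qed

lemma axis_in_unit_simplex: "axis i 1 \<in> unit_simplex"
  unfolding unit_simplex_def by (auto simp: axis_def sum.If_cases)

text \<open>Brouwer's theorem is applied to a map that pushes \<open>x\<close> towards the
  coordinates whose set \<open>K i\<close> is closer than average. At a fixed point outside some
  \<open>K i\<close> no push can remain, so all distances are equal and positive.\<close>

lemma KKM_dichotomy:
  fixes K :: "'n::finite \<Rightarrow> (real ^ 'n) set"
  assumes closed: "\<And>i. closed (K i)" and ne: "\<And>i. K i \<noteq> {}"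
    and face: "\<And>x i. x \<in> unit_simplex \<Longrightarrow> x $ i = 0 \<Longrightarrow> x \<in> K i"
  shows "\<exists>x\<in>unit_simplex. (\<forall>i. x \<in> K i) \<or> (\<forall>i. x \<notin> K i)"
proof -
  define N where "N = real CARD('n)"
  have N: "N > 0" unfolding N_def by simp
  define u where "u x i = infdist x (K i)" for x i
  define U where "U x = (\<Sum>i\<in>UNIV. u x i)" for x
  define p where "p x i = max 0 (U x / N - u x i)" for x i
  define P where "P x = (\<Sum>i\<in>UNIV. p x i)" for x
  define g where "g x = (1 / (1 + P x)) *\<^sub>R (x + (\<chi> i. p x i))" for x
  have u0: "u x i \<ge> 0" for x i unfolding u_def by (simp add: infdist_nonneg)
  have u_iff: "u x i = 0 \<longleftrightarrow> x \<in> K i" for x i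
    unfolding u_def using in_closed_iff_infdist_zero[OF closed ne] by blast
  have p0: "p x i \<ge> 0" for x i unfolding p_def by simp
  have P0: "P x \<ge> 0" for x unfolding P_def by (simp add: sum_nonneg p0)
  have cu: "continuous_on unit_simplex (\<lambda>x. u x i)" for i
    unfolding u_def by (intro continuous_intros)
  have cU: "continuous_on unit_simplex U"
    unfolding U_def by (intro continuous_intros cu)
  have cp: "continuous_on unit_simplex (\<lambda>x. p x i)" for i
    unfolding p_def using N by (intro continuous_intros cu cU) auto
  have cP: "continuous_on unit_simplex P"
    unfolding P_def by (intro continuous_intros cp)
  have "1 + P x \<noteq> 0" for x using P0[of x] by linarith
  then have cg: "continuous_on unit_simplex g"
    unfolding g_def by (intro continuous_intros cp cP) auto
  have maps: "g \<in> unit_simplex \<rightarrow> unit_simplex"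
  proof
    fix x :: "real ^ 'n" assume x: "x \<in> unit_simplex"
    have "(\<Sum>i\<in>UNIV. g x $ i) = (1 / (1 + P x)) * (\<Sum>i\<in>UNIV. x $ i + p x i)"
      unfolding g_def by (simp add: sum_divide_distrib)
    also have "\<dots> = 1"
      using x P0[of x] by (simp add: sum.distrib P_def[symmetric] unit_simplex_def)
    finally have "(\<Sum>i\<in>UNIV. g x $ i) = 1" .
    moreover have "g x $ i \<ge> 0" for i
      using x P0[of x] p0[of x i] by (simp add: g_def unit_simplex_def)
    ultimately show "g x \<in> unit_simplex" by (simp add: unit_simplex_def)
  qed
  obtain x where x: "x \<in> unit_simplex" "g x = x"
    using brouwer[OF compact_unit_simplex convex_unit_simplex _ cg maps] axis_in_unit_simplex
    by blast
  have fix_eq: "x $ i * P x = p x i" for i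
  proof -
    have "x $ i = (x $ i + p x i) / (1 + P x)"
      using arg_cong[OF x(2), of "\<lambda>y. y $ i"] by (simp add: g_def)
    then show ?thesis using P0[of x] by (simp add: field_simps)
  qed
  show ?thesis
  proof (cases "U x = 0")
    case True
    then have "u x i = 0" for i
      using sum_nonneg_eq_0_iff[of UNIV "u x"] u0 by (auto simp: U_def)
    then show ?thesis using u_iff x by blast
  next
    case False
    then have U: "U x > 0" using sum_nonneg[of UNIV "u x"] u0 by (auto simp: U_def less_le)
    have "\<exists>j. u x j \<ge> U x / N"
    proof (rule ccontr)
      assume "\<not> ?thesis"
      then have "(\<Sum>i\<in>UNIV. u x i) < (\<Sum>i\<in>(UNIV::'n set). U x / N)"
        by (intro sum_strict_mono) (auto simp: not_le)
      then show False using N by (simp add: U_def N_def)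
    qed
    then obtain j where j: "u x j \<ge> U x / N" ..
    \<comment> \<open>A distance that is at least average is positive, so \<open>face\<close> gives
      a nonzero coordinate \<open>j\<close>, whereas the push there is zero. The fixed-point
      equation then forces \<open>P x = 0\<close>.\<close>
    have "u x j > 0" using j U N by (smt (verit) divide_pos_pos)
    then have "x $ j \<noteq> 0" using face[OF x(1)] u_iff by force
    moreover have "p x j = 0" using j by (simp add: p_def)
    ultimately have "P x = 0" using fix_eq[of j] by simp
    then have "p x i = 0" for i using fix_eq[of i] by simp
    then have "u x i \<ge> U x / N" for i unfolding p_def by (smt (verit))
    then have "u x i > 0" for i using U N by (smt (verit) divide_pos_pos)
    then show ?thesis using u_iff x by (metis less_irrefl)
  qed
qed

section \<open>Chords between opposite points of a hexagon on a circle\<close>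

definition cis2 :: "real \<Rightarrow> real ^ 2" where
  "cis2 a = vector [cos a, sin a]"

lemma inner_cis2: "z \<bullet> cis2 a = z $ 1 * cos a + z $ 2 * sin a"
  by (simp add: cis2_def inner_vec_def sum_2)

text \<open>
  The points have angles \<open>t k\<close> on the circle of radius \<open>r\<close>. The chord from \<open>t k\<close> to \<open>t (k + 3)\<close> is
  the zero set, in normal form, so that it stays a line when its end points coincide. The arc from
  \<open>t k\<close> to \<open>t (k + 3)\<close> lies on the negative side.
\<close>
definition chord :: "real \<Rightarrow> (nat \<Rightarrow> real) \<Rightarrow> nat \<Rightarrow> real ^ 2 \<Rightarrow> real" where
  "chord r t k z = r * cos ((t (k + 3) - t k) / 2) - z \<bullet> cis2 ((t k + t (k + 3)) / 2)"

lemma is_line_chord: "is_line {z. chord r t k z = 0}"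
proof -
  define n where "n = cis2 ((t k + t (k + 3)) / 2)"
  have "n \<bullet> n = 1"
    unfolding inner_cis2 n_def by (simp add: cis2_def flip: power2_eq_square)
  then have "n \<noteq> 0" by auto
  moreover have "{z. chord r t k z = 0} = {z. n \<bullet> z = r * cos ((t (k + 3) - t k) / 2)}"
    by (auto simp: chord_def n_def inner_commute)
  ultimately show ?thesis
    unfolding is_line_def by (simp add: affine_hyperplane aff_dim_hyperplane)
qed

lemma convex_chord_neg: "convex {z. chord r t k z < 0}"
proof -
  have "{z. chord r t k z < 0}
    = {z. cis2 ((t k + t (k + 3)) / 2) \<bullet> z > r * cos ((t (k + 3) - t k) / 2)}"
    by (auto simp: chord_def inner_commute)
  then show ?thesis by (simp add: convex_halfspace_gt)
qed

lemma convex_chord_pos: "convex {z. chord r t k z > 0}"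
proof -
  have "{z. chord r t k z > 0}
    = {z. cis2 ((t k + t (k + 3)) / 2) \<bullet> z < r * cos ((t (k + 3) - t k) / 2)}"
    by (auto simp: chord_def inner_commute)
  then show ?thesis by (simp add: convex_halfspace_lt)
qed

text \<open>Exchanging the end points replaces half the opening angle by its supplement and rotates
  the normal by \<open>pi\<close>, so both terms change sign.\<close>

lemma chord_opposite:
  assumes "t (k + 6) = t k + 2 * pi"
  shows "chord r t (k + 3) z = - chord r t k z"
proof -
  have *: "(t (k + 6) - t (k + 3)) / 2 = pi - (t (k + 3) - t k) / 2"
    "(t (k + 3) + t (k + 6)) / 2 = (t k + t (k + 3)) / 2 + pi"
    using assms by (simp_all add: field_simps)
  have "k + 3 + 3 = k + 6" by simp
  then show ?thesis
    unfolding chord_def by (simp only: * inner_cis2) (simp add: cos_diff sin_diff)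
qed

text \<open>With the common end at angle \<open>a\<close> and half-opening \<open>y\<close>, the
  chord function is \<open>f y = p * cos y - q * sin y\<close>, where \<open>p > 0\<close> inside
  the disc. As \<open>f y / sin y\<close> decreases between 0 and \<open>pi\<close>, no positive
  value can follow a negative one. This empties the wedge over an arc of length zero.\<close>

lemma chord_through_same_point:
  assumes z: "norm z < r" and eq: "t (Suc k) = t k"
    and le: "t k \<le> t (k + 3)" "t (k + 3) \<le> t (Suc k + 3)" "t (Suc k + 3) \<le> t k + 2 * pi"
    and neg: "chord r t k z < 0"
  shows "chord r t (Suc k) z \<le> 0"
proof -
  define a s s' where "a = t k" and "s = (t (k + 3) - t k) / 2"
    and "s' = (t (Suc k + 3) - t k) / 2"
  define p q where "p = r - z \<bullet> cis2 a" and "q = z \<bullet> cis2 (a + pi / 2)"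
  define f where "f y = p * cos y - q * sin y" for y
  have s: "0 \<le> s" "s \<le> s'" "s' \<le> pi" using le by (simp_all add: s_def s'_def)
  have f: "r * cos y - z \<bullet> cis2 (a + y) = f y" for y
    by (simp add: f_def p_def q_def inner_cis2 cos_add sin_add algebra_simps)
  have mid: "(t k + t (k + 3)) / 2 = a + s" "(t (Suc k) + t (Suc k + 3)) / 2 = a + s'"
    using eq by (simp_all add: a_def s_def s'_def field_simps)
  have ch: "chord r t k z = f s" "chord r t (Suc k) z = f s'"
    unfolding chord_def mid f[symmetric] by (simp_all add: s_def s'_def eq)
  have "norm (cis2 a) = 1"
    by (simp add: norm_eq_sqrt_inner inner_cis2) (simp add: cis2_def flip: power2_eq_square)
  then have p: "p > 0"
    using norm_cauchy_schwarz[of z "cis2 a"] z by (simp add: p_def)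
  have "s \<noteq> 0" using neg p by (auto simp: ch f_def)
  show ?thesis
  proof (cases "s = pi")
    case True
    then show ?thesis using s neg ch by simp
  next
    case False
    then have sin: "sin s > 0" using s \<open>s \<noteq> 0\<close> by (intro sin_gt_zero) auto
    \<comment> \<open>Cross-multiplied monotonicity of \<open>f y / sin y\<close>, valid also when
      \<open>s' = pi\<close>.\<close>
    have "sin s * f s' = sin s' * f s - p * sin (s' - s)"
      by (simp add: f_def sin_diff algebra_simps)
    moreover have "sin s' * f s \<le> 0"
      using neg s by (intro mult_nonneg_nonpos) (auto simp: ch intro: sin_ge_zero)
    moreover have "p * sin (s' - s) \<ge> 0"
      using p s by (intro mult_nonneg_nonneg) (auto intro: sin_ge_zero)
    ultimately have "sin s * f s' \<le> 0" by linarith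
    then show ?thesis using sin ch by (simp add: mult_le_0_iff)
  qed
qed

text \<open>
  The normals satisfy a linear dependency with signs \<open>+\<close>, \<open>-\<close>, \<open>+\<close>, so the corresponding
  combination of the three chord functions is constant, although it is negative at \<open>z\<close> and positive
  at \<open>w\<close>.
\<close>
lemma alternating_signs_exclusive:
  assumes t: "\<And>k. t k < t (Suc k)" "t 6 = t 0 + 2 * pi"
    and z: "chord r t 0 z < 0" "chord r t 1 z > 0" "chord r t 2 z < 0"
    and w: "chord r t 0 w > 0" "chord r t 1 w < 0" "chord r t 2 w > 0"
  shows False
proof -
  define m where "m k = (t k + t (k + 3)) / 2" for k
  \<comment> \<open>Cramer's rule: up to sign, the coefficient of each normal is the determinant of
    the other two.\<close>
  define c where "c = sin (m 2 - m 1)"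
  define d where "d = sin (m 2 - m 0)"
  define e where "e = sin (m 1 - m 0)"
  have ord: "t 0 < t 1" "t 1 < t 2" "t 2 < t 3" "t 3 < t 4" "t 4 < t 5" "t 5 < t 6"
    using t(1)[of 0] t(1)[of 1] t(1)[of 2] t(1)[of 3] t(1)[of 4] t(1)[of 5]
    by (simp_all add: numeral_eq_Suc)
  have m: "m 0 = (t 0 + t 3) / 2" "m 1 = (t 1 + t 4) / 2" "m 2 = (t 2 + t 5) / 2"
    by (simp_all add: m_def)
  \<comment> \<open>The angles \<open>m\<close> increase, and \<open>m 2 - m 0 < pi\<close> because
    \<open>t 2 < t 3\<close> and \<open>t 5 < t 6\<close>.\<close>
  have pos: "c > 0" "d > 0" "e > 0"
    unfolding c_def d_def e_def m by (rule sin_gt_zero; use ord t(2) in argo)+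
  define f where "f y = c * chord r t 0 y - d * chord r t 1 y + e * chord r t 2 y" for y
  have dep: "c * (y \<bullet> cis2 (m 0)) + e * (y \<bullet> cis2 (m 2)) = d * (y \<bullet> cis2 (m 1))" for y
  proof -
    have "c * cos (m 0) + e * cos (m 2) = d * cos (m 1)"
      "c * sin (m 0) + e * sin (m 2) = d * sin (m 1)"
      unfolding c_def d_def e_def sin_diff by algebra+
    then show ?thesis unfolding inner_cis2 by algebra
  qed
  have "f z = f w"
    using dep[of z] dep[of w] unfolding f_def chord_def m_def[symmetric]
    by (simp add: algebra_simps)
  moreover have "f z < 0"
    using pos z mult_pos_neg[of c "chord r t 0 z"] mult_pos_pos[of d "chord r t 1 z"]
      mult_pos_neg[of e "chord r t 2 z"] unfolding f_def by linarith
  moreover have "f w > 0"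
    using pos w mult_pos_pos[of c "chord r t 0 w"] mult_pos_neg[of d "chord r t 1 w"]
      mult_pos_pos[of e "chord r t 2 w"] unfolding f_def by linarith
  ultimately show False by simp
qed

text \<open>Of the circle, the two half-planes leave in common the arc from \<open>t k\<close> to
  \<open>t (Suc k)\<close>.\<close>

definition wedge :: "real \<Rightarrow> (nat \<Rightarrow> real) \<Rightarrow> nat \<Rightarrow> (real ^ 2) set" where
  "wedge r t k = {z. chord r t k z < 0 \<and> chord r t (Suc k) z > 0}"

text \<open>By \<open>chord_opposite\<close>, the six signs at \<open>z\<close> form a cyclic
  sequence in which opposite entries differ; hence somewhere a negative sign is followed by a
  positive one. The set \<open>A\<close> shares the signs of \<open>z\<close>.\<close>

lemma wedges_cover:
  assumes t: "\<And>k. t (k + 6) = t k + 2 * pi"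
    and nz: "\<And>k. k < 3 \<Longrightarrow> chord r t k z \<noteq> 0"
    and A: "\<And>k y. y \<in> A \<Longrightarrow> k < 3 \<Longrightarrow> chord r t k z < 0 \<Longrightarrow> chord r t k y < 0"
      "\<And>k y. y \<in> A \<Longrightarrow> k < 3 \<Longrightarrow> chord r t k z > 0 \<Longrightarrow> chord r t k y > 0"
  shows "\<exists>k<6. A \<subseteq> wedge r t k"
proof -
  have opp: "chord r t 3 y = - chord r t 0 y" "chord r t 4 y = - chord r t 1 y"
    "chord r t 5 y = - chord r t 2 y" "chord r t 6 y = chord r t 0 y" for y
    using chord_opposite[of t 0 r y] chord_opposite[of t 1 r y] chord_opposite[of t 2 r y]
      chord_opposite[of t 3 r y] t[of 0] t[of 1] t[of 2] t[of 3] by (simp_all add: numeral_eq_Suc)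
  have sgn: "chord r t k z < 0 \<or> chord r t k z > 0" if "k < 3" for k
    using nz[OF that] by linarith
  have W: "y \<in> wedge r t 0 \<longleftrightarrow> chord r t 0 y < 0 \<and> chord r t 1 y > 0"
    "y \<in> wedge r t 1 \<longleftrightarrow> chord r t 1 y < 0 \<and> chord r t 2 y > 0"
    "y \<in> wedge r t 2 \<longleftrightarrow> chord r t 2 y < 0 \<and> chord r t 0 y < 0"
    "y \<in> wedge r t 3 \<longleftrightarrow> chord r t 0 y > 0 \<and> chord r t 1 y < 0"
    "y \<in> wedge r t 4 \<longleftrightarrow> chord r t 1 y > 0 \<and> chord r t 2 y < 0"
    "y \<in> wedge r t 5 \<longleftrightarrow> chord r t 2 y > 0 \<and> chord r t 0 y > 0" for y
    using opp[of y] by (simp_all add: wedge_def numeral_eq_Suc)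
  have s: "chord r t 0 z < 0 \<or> chord r t 0 z > 0" "chord r t 1 z < 0 \<or> chord r t 1 z > 0"
    "chord r t 2 z < 0 \<or> chord r t 2 z > 0"
    using sgn[of 0] sgn[of 1] sgn[of 2] by simp_all
  have "A \<subseteq> wedge r t 0 \<or> A \<subseteq> wedge r t 1 \<or> A \<subseteq> wedge r t 2 \<or> A \<subseteq> wedge r t 3
    \<or> A \<subseteq> wedge r t 4 \<or> A \<subseteq> wedge r t 5"
    using s A[of _ 0] A[of _ 1] A[of _ 2] unfolding subset_iff W by auto
  moreover have "(0::nat) < 6" "(1::nat) < 6" "(2::nat) < 6" "(3::nat) < 6" "(4::nat) < 6" "(5::nat) < 6"
    by simp_all
  ultimately show ?thesis by blast
qed

text \<open>By the intermediate value theorem, each chord function without a zero on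
  \<open>A\<close> keeps its sign there.\<close>

lemma connected_meets_chord_or_in_wedge:
  assumes "\<And>k. t (k + 6) = t k + 2 * pi" and "connected A" "A \<noteq> {}"
  shows "(\<exists>k<3. A \<inter> {z. chord r t k z = 0} \<noteq> {}) \<or> (\<exists>k<6. A \<subseteq> wedge r t k)"
proof (cases "\<exists>k<3. A \<inter> {z. chord r t k z = 0} \<noteq> {}")
  case True
  then show ?thesis ..
next
  case miss: False
  obtain z where z: "z \<in> A" using assms by blast
  have sep: "\<not> (chord r t k x < 0 \<and> chord r t k y > 0)" if "k < 3" "x \<in> A" "y \<in> A" for k x y
  proof
    assume *: "chord r t k x < 0 \<and> chord r t k y > 0"
    have "connected (chord r t k ` A)"
      unfolding chord_def by (intro connected_continuous_image assms continuous_intros)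
    then have "0 \<in> chord r t k ` A"
      using connectedD_interval[of "chord r t k ` A" "chord r t k x" "chord r t k y" 0] that *
      by auto
    then show False using miss that by fastforce
  qed
  have nz: "chord r t k y \<noteq> 0" if "k < 3" "y \<in> A" for k y using miss that by blast
  have "chord r t k y < 0" if "y \<in> A" "k < 3" "chord r t k z < 0" for k y
    using sep[OF that(2) z that(1)] nz[OF that(2,1)] that(3) by linarith
  moreover have "chord r t k y > 0" if "y \<in> A" "k < 3" "chord r t k z > 0" for k y
    using sep[OF that(2,1) z] nz[OF that(2,1)] that(3) by linarith
  ultimately have "\<exists>k<6. A \<subseteq> wedge r t k"
    using wedges_cover[of t r z A] assms(1) nz[OF _ z] by blast
  then show ?thesis ..
qed

section \<open>Tight families\<close>

text \<open>Allows members to be picked without checking that they are distinct: a repeated member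
  lies in all three convex sets and is nonempty.\<close>

lemma tight_family_convex_Int:
  assumes tight: "\<And>A B C. A \<in> \<F> \<Longrightarrow> B \<in> \<F> \<Longrightarrow> C \<in> \<F> \<Longrightarrow>
      A \<noteq> B \<Longrightarrow> A \<noteq> C \<Longrightarrow> B \<noteq> C \<Longrightarrow> tight_triple A B C"
    and ne: "\<And>A. A \<in> \<F> \<Longrightarrow> A \<noteq> {}"
    and F: "A \<in> \<F>" "B \<in> \<F>" "C \<in> \<F>"
    and conv: "convex X" "convex Y" "convex Z"
    and sub: "A \<union> B \<subseteq> X" "A \<union> C \<subseteq> Y" "B \<union> C \<subseteq> Z"
  shows "X \<inter> Y \<inter> Z \<noteq> {}"
proof (cases "A \<noteq> B \<and> A \<noteq> C \<and> B \<noteq> C")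
  case True
  then have "convex hull (A \<union> B) \<inter> convex hull (A \<union> C) \<inter> convex hull (B \<union> C) \<noteq> {}"
    using tight F unfolding tight_triple_def by blast
  then show ?thesis using hull_minimal[of _ _ convex] sub conv by blast
next
  case False
  then show ?thesis using ne F sub by blast
qed

text \<open>Any two of the wedges 0, 2, 4 share a side of one chord, and so do any two of 1, 3, 5.
  Tightness thus yields a point with signs \<open>-\<close>, \<open>+\<close>, \<open>-\<close> and
  one with the opposite signs.\<close>

lemma tight_family_not_in_all_wedges:
  assumes tight: "\<And>A B C. A \<in> \<F> \<Longrightarrow> B \<in> \<F> \<Longrightarrow> C \<in> \<F> \<Longrightarrow>
      A \<noteq> B \<Longrightarrow> A \<noteq> C \<Longrightarrow> B \<noteq> C \<Longrightarrow> tight_triple A B C"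
    and ne: "\<And>A. A \<in> \<F> \<Longrightarrow> A \<noteq> {}"
    and t: "\<And>k. t k < t (Suc k)" "\<And>k. t (k + 6) = t k + 2 * pi"
    and occ: "\<And>k. k < 6 \<Longrightarrow> \<exists>A\<in>\<F>. A \<subseteq> wedge r t k"
  shows False
proof -
  have opp: "chord r t 3 y = - chord r t 0 y" "chord r t 4 y = - chord r t 1 y"
    "chord r t 5 y = - chord r t 2 y" "chord r t 6 y = chord r t 0 y" for y
    using chord_opposite[of t 0 r y] chord_opposite[of t 1 r y] chord_opposite[of t 2 r y]
      chord_opposite[of t 3 r y] t(2)[of 0] t(2)[of 1] t(2)[of 2] t(2)[of 3]
    by (simp_all add: numeral_eq_Suc)
  let ?N = "\<lambda>k. {z. chord r t k z < 0}" and ?P = "\<lambda>k. {z. chord r t k z > 0}"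
  have W: "wedge r t 0 \<subseteq> ?N 0 \<inter> ?P 1" "wedge r t 1 \<subseteq> ?N 1 \<inter> ?P 2"
    "wedge r t 2 \<subseteq> ?N 2 \<inter> ?N 0" "wedge r t 3 \<subseteq> ?P 0 \<inter> ?N 1"
    "wedge r t 4 \<subseteq> ?P 1 \<inter> ?N 2" "wedge r t 5 \<subseteq> ?P 2 \<inter> ?P 0"
    using opp by (auto simp: wedge_def numeral_eq_Suc)
  obtain A0 where A0: "A0 \<in> \<F>" "A0 \<subseteq> wedge r t 0" using occ[of 0] by auto
  obtain A1 where A1: "A1 \<in> \<F>" "A1 \<subseteq> wedge r t 1" using occ[of 1] by auto
  obtain A2 where A2: "A2 \<in> \<F>" "A2 \<subseteq> wedge r t 2" using occ[of 2] by auto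
  obtain A3 where A3: "A3 \<in> \<F>" "A3 \<subseteq> wedge r t 3" using occ[of 3] by auto
  obtain A4 where A4: "A4 \<in> \<F>" "A4 \<subseteq> wedge r t 4" using occ[of 4] by auto
  obtain A5 where A5: "A5 \<in> \<F>" "A5 \<subseteq> wedge r t 5" using occ[of 5] by auto
  have "?N 0 \<inter> ?P 1 \<inter> ?N 2 \<noteq> {}"
    using A0(2) A2(2) A4(2) W
    by (intro tight_family_convex_Int[OF tight ne A0(1) A2(1) A4(1)]
        convex_chord_neg convex_chord_pos) blast+
  moreover have "?N 1 \<inter> ?P 2 \<inter> ?P 0 \<noteq> {}"
    using A1(2) A3(2) A5(2) W
    by (intro tight_family_convex_Int[OF tight ne A1(1) A3(1) A5(1)]
        convex_chord_neg convex_chord_pos) blast+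
  moreover have "t 6 = t 0 + 2 * pi" using t(2)[of 0] by simp
  ultimately show False using alternating_signs_exclusive[of t r, OF t(1)] by blast
qed

section \<open>From arc lengths in the simplex to three lines meeting all members\<close>

lemma tight_family_three_lines:
  fixes \<F> :: "(real ^ 2) set set"
  assumes fin: "finite \<F>"
    and cc: "\<And>A. A \<in> \<F> \<Longrightarrow> A \<noteq> {} \<and> compact A \<and> connected A"
    and tight: "\<And>A B C. A \<in> \<F> \<Longrightarrow> B \<in> \<F> \<Longrightarrow> C \<in> \<F> \<Longrightarrow>
      A \<noteq> B \<Longrightarrow> A \<noteq> C \<Longrightarrow> B \<noteq> C \<Longrightarrow> tight_triple A B C"
  shows "\<exists>l. (\<forall>k<3. is_line (l k)) \<and> (\<forall>A\<in>\<F>. \<exists>k<(3::nat). A \<inter> l k \<noteq> {})"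
proof (cases "\<F> = {}")
  case True
  then show ?thesis
    using is_line_chord[of 0 "\<lambda>_. 0"] by (intro exI[of _ "\<lambda>k. {z. chord 0 (\<lambda>_. 0) k z = 0}"]) blast
next
  case False
  have "bounded (\<Union>\<F>)" using fin cc by (intro bounded_Union ballI compact_imp_bounded) auto
  then obtain r where "\<forall>z\<in>\<Union>\<F>. norm z < r" unfolding bounded_pos_less by blast
  then have r: "norm z < r" if "z \<in> A" "A \<in> \<F>" for z A using that by blast
  obtain h :: "6 \<Rightarrow> nat" where h: "bij_betw h UNIV {0..<6}"
    using ex_bij_betw_finite_nat[of "UNIV :: 6 set"] by auto
  \<comment> \<open>Lists the six coordinates cyclically, so that the points can be continued past a
    full turn.\<close>
  define g where "g k = inv_into UNIV h (k mod 6)" for k :: nat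
  have hg: "h (g k) = k mod 6" for k
    unfolding g_def using h by (intro f_inv_into_f) (auto simp: bij_betw_def)
  have gh: "g (h i) = i" for i
  proof -
    have "h i < 6" using h by (auto simp: bij_betw_def)
    then show ?thesis unfolding g_def using h by (simp add: bij_betw_def)
  qed
  have g6: "bij_betw g {..<6} UNIV"
    by (rule bij_betwI[where g = h]) (use h in \<open>auto simp: hg gh bij_betw_def\<close>)
  \<comment> \<open>The coordinates are arc lengths as fractions of the full turn; their sum 1
    yields the period in \<open>per\<close>.\<close>
  define t where "t x k = 2 * pi * (\<Sum>j<k. x $ g j)" for x :: "real ^ 6" and k :: nat
  have tSuc: "t x (Suc k) = t x k + 2 * pi * x $ g k" for x k
    by (simp add: t_def algebra_simps)
  have per: "t x (k + 6) = t x k + 2 * pi" if "x \<in> unit_simplex" for x k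
  proof (induction k)
    case 0
    have "(\<Sum>j<6. x $ g j) = (\<Sum>i\<in>UNIV. x $ i)"
      by (rule sum.reindex_bij_betw[OF g6])
    then show ?case using that by (simp add: t_def unit_simplex_def)
  next
    case (Suc k)
    have "g (k + 6) = g k" by (simp add: g_def)
    then show ?case using Suc tSuc[of x k] tSuc[of x "k + 6"] by simp
  qed
  have mono: "t x k \<le> t x k'" if "x \<in> unit_simplex" "k \<le> k'" for x k k'
    using that(2) by (rule lift_Suc_mono_le[of "t x", rotated])
      (use that(1) in \<open>simp add: tSuc unit_simplex_def\<close>)
  define M where "M k A = {x \<in> unit_simplex. \<not> A \<subseteq> wedge r (t x) k}" for k A
  \<comment> \<open>On the simplex, \<open>K i\<close> collects the configurations whose wedge over
    arc \<open>i\<close> contains no member.\<close>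
  define K where "K i = (\<Inter>A\<in>\<F>. M (h i) A)" for i
  have closedM: "closed (M k A)" if "A \<in> \<F>" for k A
  proof -
    have cont: "continuous_on (unit_simplex \<times> A) (\<lambda>xz. chord r (t (fst xz)) j (snd xz))" for j
      unfolding chord_def inner_cis2 t_def by (intro continuous_intros) auto
    \<comment> \<open>\<open>M k A\<close> is the projection of the compact set of pairs consisting
      of a configuration and a point of \<open>A\<close> outside its wedge.\<close>
    define D where "D = {xz \<in> unit_simplex \<times> A.
      chord r (t (fst xz)) k (snd xz) \<ge> 0 \<or> chord r (t (fst xz)) (Suc k) (snd xz) \<le> 0}"
    have cp: "compact (unit_simplex \<times> A)"
      using cc[OF that] compact_unit_simplex by (intro compact_Times) auto
    have "closed {xz \<in> unit_simplex \<times> A. 0 \<le> chord r (t (fst xz)) k (snd xz)}"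
      "closed {xz \<in> unit_simplex \<times> A. chord r (t (fst xz)) (Suc k) (snd xz) \<le> 0}"
      by (rule continuous_on_closed_Collect_le[OF continuous_on_const cont compact_imp_closed[OF cp]],
          rule continuous_on_closed_Collect_le[OF cont continuous_on_const compact_imp_closed[OF cp]])
    then have "closed D" unfolding D_def Collect_disj_eq conj_disj_distribL by (rule closed_Un)
    moreover have "D \<subseteq> unit_simplex \<times> A" by (auto simp: D_def)
    ultimately have "compact D" using cp compact_eq_bounded_closed bounded_subset by metis
    then have "compact (fst ` D)" by (intro compact_continuous_image continuous_intros)
    moreover have "fst ` D = M k A"
      unfolding D_def M_def wedge_def image_def by (force simp: not_less)
    ultimately show ?thesis using compact_imp_closed by simp
  qed
  \<comment> \<open>Arc \<open>i\<close> has length zero, so its wedge misses the disc, while every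
    member is a nonempty subset of the disc.\<close>
  have face: "x \<in> K i" if x: "x \<in> unit_simplex" "x $ i = 0" for x i
  proof -
    let ?k = "h i"
    have eq: "t x (Suc ?k) = t x ?k" using x tSuc gh by simp
    have "\<not> A \<subseteq> wedge r (t x) ?k" if A: "A \<in> \<F>" for A
    proof
      assume sub: "A \<subseteq> wedge r (t x) ?k"
      obtain z where z: "z \<in> A" using cc A by blast
      then have *: "chord r (t x) ?k z < 0" "chord r (t x) (Suc ?k) z > 0"
        using sub by (auto simp: wedge_def)
      have "chord r (t x) (Suc ?k) z \<le> 0"
      proof (rule chord_through_same_point[OF r[OF z A] eq _ _ _ *(1)])
        show "t x (Suc ?k + 3) \<le> t x ?k + 2 * pi"
          using mono[OF x(1), of "Suc ?k + 3" "?k + 6"] per[OF x(1), of ?k] by simp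
      qed (use mono x in auto)
      then show False using * by simp
    qed
    then show ?thesis using x by (auto simp: K_def M_def)
  qed
  have closedK: "closed (K i)" for i unfolding K_def using closedM by blast
  have neK: "K i \<noteq> {}" for i
  proof -
    obtain j :: 6 where "j \<noteq> i" by (metis zero_neq_one)
    then have "axis j 1 $ i = (0::real)" by (simp add: axis_def)
    then show ?thesis using face[OF axis_in_unit_simplex] by blast
  qed
  obtain x where x: "x \<in> unit_simplex" "(\<forall>i. x \<in> K i) \<or> (\<forall>i. x \<notin> K i)"
    using KKM_dichotomy[of K, OF closedK neK face] by blast
  have K_iff: "x \<in> K (g k) \<longleftrightarrow> \<not> (\<exists>A\<in>\<F>. A \<subseteq> wedge r (t x) k)" if "k < 6" for k
    using that x False by (auto simp: K_def M_def hg)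
  show ?thesis
  proof (cases "\<forall>i. x \<in> K i")
    case True
    then have "\<not> A \<subseteq> wedge r (t x) k" if "A \<in> \<F>" "k < 6" for A k
      using K_iff that by blast
    then have "\<exists>k<3. A \<inter> {z. chord r (t x) k z = 0} \<noteq> {}" if "A \<in> \<F>" for A
      using connected_meets_chord_or_in_wedge[of "t x" A r] per[OF x(1)] cc that by blast
    then show ?thesis
      using is_line_chord by (intro exI[of _ "\<lambda>k. {z. chord r (t x) k z = 0}"]) blast
  next
    case notall: False
    then have notK: "x \<notin> K i" for i using x by blast
    \<comment> \<open>By \<open>face\<close>, avoiding every \<open>K i\<close> rules out arcs of
      length zero, so the angles increase strictly.\<close>
    then have "x $ i > 0" for i using face[OF x(1), of i] x(1) by (auto simp: unit_simplex_def less_le)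
    then have "t x k < t x (Suc k)" for k by (simp add: tSuc)
    then have False
      using tight_family_not_in_all_wedges[of \<F> "t x" r, OF tight] cc per[OF x(1)] K_iff notK
      by blast
    then show ?thesis ..
  qed
qed

section \<open>Pigeonhole over the three lines\<close>

theorem mainTheorem4:
  fixes \<F> :: "(real ^ 2) set set"
  assumes "finite \<F>"
    and "\<And>A. A \<in> \<F> \<Longrightarrow> A \<noteq> {} \<and> compact A \<and> convex A"
    and "\<And>A B C. A \<in> \<F> \<Longrightarrow> B \<in> \<F> \<Longrightarrow> C \<in> \<F> \<Longrightarrow>
           A \<noteq> B \<Longrightarrow> A \<noteq> C \<Longrightarrow> B \<noteq> C \<Longrightarrow> tight_triple A B C"
  shows "\<exists>L. is_line L \<and> real (card {A \<in> \<F>. A \<inter> L \<noteq> {}}) \<ge> 1 / 3 * real (card \<F>)"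
proof -
  have "\<exists>l. (\<forall>k<3. is_line (l k)) \<and> (\<forall>A\<in>\<F>. \<exists>k<(3::nat). A \<inter> l k \<noteq> {})"
    using assms convex_connected by (intro tight_family_three_lines) blast+
  then obtain l :: "nat \<Rightarrow> (real ^ 2) set"
    where l: "\<And>k. k < 3 \<Longrightarrow> is_line (l k)" "\<And>A. A \<in> \<F> \<Longrightarrow> \<exists>k<3. A \<inter> l k \<noteq> {}"
    by blast
  define S where "S k = {A \<in> \<F>. A \<inter> l k \<noteq> {}}" for k
  have "card \<F> \<le> card (\<Union>k<3. S k)"
    using l(2) assms(1) by (intro card_mono) (force simp: S_def)+
  also have "\<dots> \<le> (\<Sum>k<3. card (S k))" by (rule card_UN_le) simp
  finally have sum: "card \<F> \<le> (\<Sum>k<3. card (S k))" .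
  have "\<exists>k<3. card \<F> \<le> 3 * card (S k)"
  proof (rule ccontr)
    assume "\<not> ?thesis"
    then have "(\<Sum>k<3. 3 * card (S k)) < (\<Sum>k<(3::nat). card \<F>)"
      by (intro sum_strict_mono) (auto simp: not_le lessThan_empty_iff)
    then show False using sum by (simp add: sum_distrib_left[symmetric])
  qed
  then obtain k where "k < 3" "card \<F> \<le> 3 * card (S k)" by blast
  then show ?thesis using l(1)[of k] by (intro exI[of _ "l k"]) (auto simp: S_def)
qed

end
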